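(* For every real $\xi>(\log 2)^{-1}$ there exists a positive constant $C$, depending only on $\xi$, such that the following holds. Let $t=(t_j)_{j\ge1}$ be a sequence of real numbers with $0<t_j<1$ for all $j$ and $t_j\to 0$, such that the sequence $(\tau_j):=\eta(t)$ is decreasing. Let $N\ge 3$ be an integer and set $r_N=[\xi\log N]+\kappa(t)$. Then, for arbitrary numbers $1>v_1\ge v_2\ge\cdots\ge v_{r_N}$ satisfying also $v_j>\tau_j^2$ for $1\le j\le r_N$, we have $$\Gamma_t(N)\le \prod_{j=1}^{r_N}(1-v_j)^{-1}(1-v_j^{-1}\tau_j^2)^{-1}\prod_{k=r_N+1}^{N-1}(1-v_{r_N}^{-1}\tau_k^2)^{-1}+\exp\left(C\sum_{\ell=1}^{N-1}t_\ell^2\right).$$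
   Context: A multi-index is a sequence $\beta=(\beta^{(1)},\beta^{(2)},\dots)$ of nonnegative integers with only finitely many nonzero entries. For multi-indices $\beta,\mu$, $|\beta-\mu|$ denotes the multi-index $(|\beta^{(j)}-\mu^{(j)}|)_j$. For a sequence $t=(t_j)$ and a multi-index $\beta$, $t^\beta:=\prod_j t_j^{\beta^{(j)}}$. For a set $B=\{\beta_1,\dots,\beta_N\}$ of $N$ distinct multi-indices, $$S(t,B):=\frac1N\sum_{k,\ell=1}^N t^{|\beta_k-\beta_\ell|},\qquad \Gamma_t(N):=\sup_B S(t,B),$$ where the supremum is over all sets $B$ of $N$ distinct multi-indices. The function $\eta:(0,1)\to(0,1)$ is $\eta(x)=2x$ for $0<x<1/2$ and $\eta(x)=x$ for $1/2\le x<1$; for a sequence, $\eta(t):=(\eta(t_j))_j$. The number $\kappa(t)$ is $\max\{j: t_j\ge 1/2\}$, and $\kappa(t)=0$ if no $j$ satisfies $t_j\ge1/2$. $[x]$ is the integer part of $x$, $\log$ is the natural logarithm, and empty products equal $1$. *)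

theory Defs
  imports Complex_Main
begin

text \<open>
  Sequences are indexed by \<open>j = 1, 2, \<dots>\<close>. For a sequence of reals \<open>t :: nat \<Rightarrow> real\<close> the value at 0
  is never used; for a multi-index the entry at 0 is fixed to be 0, so that distinct
  functions represent distinct multi-indices.
\<close>

definition multi_indices :: "(nat \<Rightarrow> nat) set" where
  "multi_indices = {\<beta>. \<beta> 0 = 0 \<and> finite {j. \<beta> j \<noteq> 0}}"

definition abs_diff :: "(nat \<Rightarrow> nat) \<Rightarrow> (nat \<Rightarrow> nat) \<Rightarrow> nat \<Rightarrow> nat" where
  "abs_diff \<beta> \<mu> = (\<lambda>j. nat \<bar>int (\<beta> j) - int (\<mu> j)\<bar>)"

definition mi_power :: "(nat \<Rightarrow> real) \<Rightarrow> (nat \<Rightarrow> nat) \<Rightarrow> real" where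
  "mi_power t \<beta> = (\<Prod>j\<in>{j. \<beta> j \<noteq> 0}. t j ^ \<beta> j)"

definition S :: "(nat \<Rightarrow> real) \<Rightarrow> (nat \<Rightarrow> nat) set \<Rightarrow> real" where
  "S t B = (1 / real (card B)) * (\<Sum>\<beta>\<in>B. \<Sum>\<mu>\<in>B. mi_power t (abs_diff \<beta> \<mu>))"

text \<open>
  For \<open>N \<ge> 1\<close>, \<open>card B = N\<close> entails that \<open>B\<close> is finite. The supremum is one of real numbers; it is
  over a nonempty set bounded above whenever all \<open>t j\<close> lie in the unit interval
  (lemmas \<open>index_sets_nonempty\<close> and \<open>bdd_above_S\<close> below).
\<close>

definition index_sets :: "nat \<Rightarrow> (nat \<Rightarrow> nat) set set" where
  "index_sets N = {B. B \<subseteq> multi_indices \<and> card B = N}"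

definition Gamma_sup :: "(nat \<Rightarrow> real) \<Rightarrow> nat \<Rightarrow> real" where
  "Gamma_sup t N = (SUP B\<in>index_sets N. S t B)"

definition eta :: "real \<Rightarrow> real" where
  "eta x = (if x < 1/2 then 2 * x else x)"

text \<open>The set below is finite if \<open>t\<close> tends to 0, so that the maximum is meaningful.\<close>

definition kappa :: "(nat \<Rightarrow> real) \<Rightarrow> nat" where
  "kappa t = (if \<exists>j\<ge>1. t j \<ge> 1/2 then Max {j. j \<ge> 1 \<and> t j \<ge> 1/2} else 0)"

lemma index_sets_nonempty: "index_sets N \<noteq> {}"
proof -
  define f :: "nat \<Rightarrow> nat \<Rightarrow> nat" where "f n = (\<lambda>j. if j = 1 then n else 0)" for n
  have "f n \<in> multi_indices" for n
    unfolding multi_indices_def f_def by (auto intro: finite_subset[of _ "{1}"])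
  moreover have "inj f"
    by (rule injI) (metis f_def)
  then have "card (f ` {..<N}) = N"
    by (metis card_image card_lessThan inj_on_subset subset_UNIV)
  ultimately have "f ` {..<N} \<in> index_sets N"
    unfolding index_sets_def by blast
  then show ?thesis by blast
qed

lemma bdd_above_S:
  assumes "\<forall>j\<ge>1. 0 < t j \<and> t j < 1"
  shows "bdd_above (S t ` index_sets N)"
proof (rule bdd_aboveI2)
  fix B assume B: "B \<in> index_sets N"
  have le1: "mi_power t (abs_diff \<beta> \<mu>) \<le> 1" if "\<beta> \<in> B" "\<mu> \<in> B" for \<beta> \<mu>
    unfolding mi_power_def
  proof (rule prod_le_1)
    fix j assume "j \<in> {j. abs_diff \<beta> \<mu> j \<noteq> 0}"
    moreover have "\<beta> \<in> multi_indices" "\<mu> \<in> multi_indices"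
      using that B by (auto simp: index_sets_def)
    then have "abs_diff \<beta> \<mu> 0 = 0"
      by (simp add: multi_indices_def abs_diff_def)
    ultimately have "j \<ge> 1" by (metis (mono_tags) less_one mem_Collect_eq not_less)
    then have "0 < t j" "t j < 1" using assms by auto
    then show "0 \<le> t j ^ abs_diff \<beta> \<mu> j \<and> t j ^ abs_diff \<beta> \<mu> j \<le> 1"
      by (simp add: power_le_one)
  qed
  have "(\<Sum>\<beta>\<in>B. \<Sum>\<mu>\<in>B. mi_power t (abs_diff \<beta> \<mu>)) \<le> (\<Sum>\<beta>\<in>B. \<Sum>\<mu>\<in>B. 1)"
    by (intro sum_mono le1)
  also have "\<dots> = real (card B) * real (card B)" by simp
  finally have "S t B \<le> (1 / real (card B)) * (real (card B) * real (card B))"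
    unfolding S_def by (intro mult_left_mono) auto
  also have "\<dots> \<le> real N" using B by (simp add: index_sets_def)
  finally show "S t B \<le> real N" .
qed

lemma kappa_set_finite:
  assumes "t \<longlonglongrightarrow> 0"
  shows "finite {j. j \<ge> 1 \<and> t j \<ge> (1/2 :: real)}"
proof -
  obtain M where "\<forall>n\<ge>M. t n < 1/2"
    using order_tendstoD(2)[OF assms, of "1/2"] by (auto simp: eventually_sequentially)
  then have "{j. j \<ge> 1 \<and> t j \<ge> 1/2} \<subseteq> {..<M}"
    by (auto simp: not_le[symmetric])
  then show ?thesis using finite_subset by blast
qed

end

theory Submission
  imports Defs "HOL-Library.FuncSet"
begin

text \<open>
  At most \<open>N - 1\<close> coordinates already separate the \<open>N\<close> multi-indices of \<open>B\<close>, and forgetting the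
  others only increases \<open>S t B\<close>. In a coordinate with \<open>t\<^sub>j < 1/2\<close>, replacing every fibre of \<open>B\<close> by
  the initial segment of the same cardinality does not decrease the sum once \<open>t\<^sub>j\<close> is replaced by
  \<open>2 t\<^sub>j = \<tau>\<^sub>j\<close>. The resulting set is closed downwards in all these coordinates, so each of its
  elements has at most \<open>log N / log 2\<close> nonzero entries there, hence at most \<open>r\<^sub>N\<close> nonzero entries
  in total.

  For \<open>p\<^sub>j q\<^sub>j = \<tau>\<^sub>j\<^sup>2\<close> the AM-GM inequality replaces \<open>\<tau>\<^bsup>|\<beta>-\<mu>|\<^esup>\<close> by
  \<open>p\<^bsup>(\<beta>-\<mu>)\<^sub>+\<^esup> q\<^bsup>(\<mu>-\<beta>)\<^sub>+\<^esup>\<close> in the double sum. Summing freely over \<open>\<mu>\<close>, a factor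
  \<open>(1-q\<^sub>j)\<^sup>-\<^sup>1\<close> arises from every coordinate, but a factor \<open>(1-p\<^sub>j)\<^sup>-\<^sup>1\<close> only from those with
  \<open>\<beta>\<^sub>j \<noteq> 0\<close>. Choosing for \<open>p\<^sub>j\<close> the number \<open>v\<close> whose index is the position of \<open>j\<close> among the
  separating coordinates (capped at \<open>r\<^sub>N\<close>) gives the product in the theorem.
\<close>

section \<open>One-dimensional comparison of distance sums with sums over intervals\<close>

lemma sum_power_le_initial:
  fixes x :: real
  assumes "finite D" "0 \<le> x" "x \<le> 1"
  shows "(\<Sum>d\<in>D. x ^ d) \<le> (\<Sum>i<card D. x ^ i)"
  using assms(1)
proof (induction D rule: finite_linorder_max_induct)
  case empty
  then show ?case by simp
next
  case (insert d D)
  have "D \<subseteq> {..<d}" using insert by auto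
  then have "card D \<le> d" by (metis card_lessThan card_mono finite_lessThan)
  then have "x ^ d \<le> x ^ card D" using assms by (intro power_decreasing) auto
  moreover have "d \<notin> D" using insert by blast
  ultimately show ?case using insert by simp
qed

text \<open>The k-th smallest element of \<open>I\<close> is at least k, so antitonicity bounds its
  factor by \<open>g k\<close>.\<close>

lemma prod_le_initial_prod:
  fixes g :: "nat \<Rightarrow> real"
  assumes "finite I" "I \<subseteq> {1..}"
    and nn: "\<And>i. 1 \<le> i \<Longrightarrow> 0 \<le> g i"
    and anti: "\<And>i k. 1 \<le> i \<Longrightarrow> i \<le> k \<Longrightarrow> g k \<le> g i"
  shows "(\<Prod>i\<in>I. g i) \<le> (\<Prod>i=1..card I. g i)"
  using assms(1,2)
proof (induction I rule: finite_linorder_max_induct)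
  case empty
  then show ?case by simp
next
  case (insert d D)
  have "D \<subseteq> {1..<d}" using insert by auto
  then have "card D \<le> d - 1" by (metis card_atLeastLessThan card_mono finite_atLeastLessThan)
  moreover have "1 \<le> d" using insert by simp
  ultimately have "g d \<le> g (Suc (card D))" by (intro anti) auto
  moreover have "d \<notin> D" using insert by blast
  moreover have "0 \<le> (\<Prod>i\<in>D. g i)" using insert by (intro prod_nonneg nn) auto
  moreover have "0 \<le> g d" using \<open>1 \<le> d\<close> nn by blast
  ultimately show ?case using insert by (simp add: mult.commute mult_mono)
qed

text \<open>The form \<open>2 ^ d\<close> covers d = 0, where only \<open>a\<close> itself
  qualifies, together with the at most two points at a positive distance.\<close>

lemma card_at_distance_le:
  "card {b \<in> A. nat \<bar>int a - int b\<bar> = d} \<le> 2 ^ d"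
proof (cases "d = 0")
  case True
  then have "{b \<in> A. nat \<bar>int a - int b\<bar> = d} \<subseteq> {a}" by auto
  then have "card {b \<in> A. nat \<bar>int a - int b\<bar> = d} \<le> card {a}" by (intro card_mono) auto
  then show ?thesis using True by simp
next
  case False
  have "{b \<in> A. nat \<bar>int a - int b\<bar> = d} \<subseteq> {a - d, a + d}" by auto
  then have "card {b \<in> A. nat \<bar>int a - int b\<bar> = d} \<le> card {a - d, a + d}"
    by (intro card_mono) auto
  also have "\<dots> \<le> 2" by (simp add: card_insert_if)
  also have "\<dots> \<le> 2 ^ d" using False self_le_power[of 2 d] by simp
  finally show ?thesis .
qed

text \<open>
  At most two points of \<open>A\<close> lie at each distance \<open>d > 0\<close> from \<open>a\<close>, and \<open>2 x\<^sup>d \<le> (2 x)\<^sup>d\<close>: this is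
  where the doubling in \<^const>\<open>eta\<close> comes from.
\<close>

lemma row_le_geometric:
  fixes x :: real
  assumes "finite A" "0 \<le> x" "x \<le> 1/2"
  shows "(\<Sum>b\<in>A. x ^ nat \<bar>int a - int b\<bar>) \<le> (\<Sum>i<card A. (2 * x) ^ i)"
proof -
  let ?d = "\<lambda>b. nat \<bar>int a - int b\<bar>"
  have "(\<Sum>b\<in>A. x ^ ?d b) = (\<Sum>d\<in>?d ` A. \<Sum>b\<in>{b \<in> A. ?d b = d}. x ^ ?d b)"
    using assms(1) by (rule sum.image_gen)
  also have "\<dots> = (\<Sum>d\<in>?d ` A. real (card {b \<in> A. ?d b = d}) * x ^ d)"
    by (intro sum.cong) auto
  also have "\<dots> \<le> (\<Sum>d\<in>?d ` A. 2 ^ d * x ^ d)"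
  proof (intro sum_mono mult_right_mono)
    fix d show "real (card {b \<in> A. ?d b = d}) \<le> 2 ^ d"
      using card_at_distance_le[of A a d] by (metis of_nat_le_iff of_nat_numeral of_nat_power)
  qed (use assms in auto)
  also have "\<dots> = (\<Sum>d\<in>?d ` A. (2 * x) ^ d)" by (simp add: power_mult_distrib)
  also have "\<dots> \<le> (\<Sum>i<card (?d ` A). (2 * x) ^ i)"
    using assms by (intro sum_power_le_initial) auto
  also have "\<dots> \<le> (\<Sum>i<card A. (2 * x) ^ i)"
    using assms card_image_le[OF assms(1), of ?d] by (intro sum_mono2) auto
  finally show ?thesis .
qed

text \<open>The points up to \<open>a\<close> realise exactly the distances 0, ..., a, and a point b
  > a lies at distance b - a, which is at most b.\<close>

lemma geometric_le_interval_row: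
  fixes x :: real
  assumes "a < n" "0 \<le> x" "x \<le> 1"
  shows "(\<Sum>i<n. x ^ i) \<le> (\<Sum>b<n. x ^ nat \<bar>int a - int b\<bar>)"
proof -
  have split: "{..<n} = {..a} \<union> {a<..<n}" using assms(1) by auto
  have "(\<Sum>i\<in>{..a}. x ^ i) = (\<Sum>b\<in>{..a}. x ^ nat \<bar>int a - int b\<bar>)"
    by (rule sum.reindex_bij_witness[of _ "\<lambda>b. a - b" "\<lambda>i. a - i"]) auto
  moreover have "(\<Sum>i\<in>{a<..<n}. x ^ i) \<le> (\<Sum>b\<in>{a<..<n}. x ^ nat \<bar>int a - int b\<bar>)"
    using assms by (intro sum_mono power_decreasing) auto
  ultimately show ?thesis
    unfolding split by (subst (1 2) sum.union_disjoint) auto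
qed

lemma double_sum_le_intervals:
  fixes x :: real
  assumes "finite A" "finite A'" "0 \<le> x" "x \<le> 1/2"
  shows "(\<Sum>a\<in>A. \<Sum>b\<in>A'. x ^ nat \<bar>int a - int b\<bar>)
    \<le> (\<Sum>a<card A. \<Sum>b<card A'. (2 * x) ^ nat \<bar>int a - int b\<bar>)"
proof -
  \<comment> \<open>Having \<open>card A \<le> card A'\<close> places each a < \<open>card A\<close>
    inside the second interval, as \<open>geometric_le_interval_row\<close> demands; symmetry of the
    distance settles the other case.\<close>
  have *: "(\<Sum>a\<in>A. \<Sum>b\<in>A'. x ^ nat \<bar>int a - int b\<bar>)
      \<le> (\<Sum>a<card A. \<Sum>b<card A'. (2 * x) ^ nat \<bar>int a - int b\<bar>)"
    if "finite A" "finite A'" "card A \<le> card A'" for A A'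
  proof -
    have "(\<Sum>a\<in>A. \<Sum>b\<in>A'. x ^ nat \<bar>int a - int b\<bar>) \<le> (\<Sum>a\<in>A. \<Sum>i<card A'. (2 * x) ^ i)"
      using that assms by (intro sum_mono row_le_geometric) auto
    also have "\<dots> = (\<Sum>a<card A. \<Sum>i<card A'. (2 * x) ^ i)" by simp
    also have "\<dots> \<le> (\<Sum>a<card A. \<Sum>b<card A'. (2 * x) ^ nat \<bar>int a - int b\<bar>)"
      using that assms by (intro sum_mono geometric_le_interval_row) auto
    finally show ?thesis .
  qed
  show ?thesis
  proof (cases "card A \<le> card A'")
    case True
    then show ?thesis using * assms by blast
  next
    case False
    then have "card A' \<le> card A" by simp
    from *[OF assms(2,1) this] show ?thesis
      by (subst (1 2) sum.swap) (simp add: abs_minus_commute)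
  qed
qed

section \<open>Compression of a finite set along a coordinate\<close>

definition fiber :: "(nat \<Rightarrow> nat) set \<Rightarrow> nat \<Rightarrow> (nat \<Rightarrow> nat) \<Rightarrow> nat set" where
  "fiber B j \<delta> = {a. \<delta>(j := a) \<in> B}"

text \<open>A fibre does not depend on the entry of its argument at \<open>j\<close>, so comparing
  \<open>\<beta> j\<close> with the size of the fibre through \<open>\<beta>\<close> itself replaces
  each finite fibre by an initial segment without choosing base points.\<close>

definition compress :: "nat \<Rightarrow> (nat \<Rightarrow> nat) set \<Rightarrow> (nat \<Rightarrow> nat) set" where
  "compress j B = {\<beta>. \<beta> j < card (fiber B j \<beta>)}"

definition down_closed_at :: "nat \<Rightarrow> (nat \<Rightarrow> nat) set \<Rightarrow> bool" where
  "down_closed_at j B \<longleftrightarrow> (\<forall>\<beta>\<in>B. \<forall>c\<le>\<beta> j. \<beta>(j := c) \<in> B)"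

text \<open>A fixed index set in place of the varying supports in \<open>mi_power\<close> lets one
  coordinate be split off for all pairs at once.\<close>

definition kernel_sum :: "nat set \<Rightarrow> (nat \<Rightarrow> real) \<Rightarrow> (nat \<Rightarrow> nat) set \<Rightarrow> real" where
  "kernel_sum J s B = (\<Sum>\<beta>\<in>B. \<Sum>\<mu>\<in>B. \<Prod>j\<in>J. s j ^ abs_diff \<beta> \<mu> j)"

lemma fiber_upd [simp]: "fiber B j (\<delta>(j := a)) = fiber B j \<delta>"
  by (simp add: fiber_def)

lemma finite_fiber:
  assumes "finite B"
  shows "finite (fiber B j \<delta>)"
proof -
  have "fiber B j \<delta> \<subseteq> (\<lambda>\<beta>. \<beta> j) ` B"
  proof
    fix a assume "a \<in> fiber B j \<delta>"
    then show "a \<in> (\<lambda>\<beta>. \<beta> j) ` B"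
      unfolding fiber_def by (intro image_eqI[of _ _ "\<delta>(j := a)"]) auto
  qed
  then show ?thesis using assms finite_surj by blast
qed

lemma fiber_compress: "fiber (compress j B) j \<delta> = {..<card (fiber B j \<delta>)}"
  unfolding fiber_def[of "compress j B"] by (auto simp: compress_def)

text \<open>Each line in direction \<open>j\<close> is represented by its point with entry 0 at
  \<open>j\<close>.\<close>

lemma fiber_nonempty_iff: "fiber B j \<delta> \<noteq> {} \<longleftrightarrow> \<delta>(j := 0) \<in> (\<lambda>\<beta>. \<beta>(j := 0)) ` B"
proof
  assume "fiber B j \<delta> \<noteq> {}"
  then obtain a where "\<delta>(j := a) \<in> B" by (auto simp: fiber_def)
  then show "\<delta>(j := 0) \<in> (\<lambda>\<beta>. \<beta>(j := 0)) ` B" 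
    by (intro image_eqI[of _ _ "\<delta>(j := a)"]) auto
next
  assume "\<delta>(j := 0) \<in> (\<lambda>\<beta>. \<beta>(j := 0)) ` B"
  then obtain \<beta> where "\<beta> \<in> B" "\<delta>(j := 0) = \<beta>(j := 0)" by auto
  then have "\<delta>(j := \<beta> j) = \<beta>" by (metis fun_upd_triv fun_upd_upd)
  then have "\<beta> j \<in> fiber B j \<delta>" using \<open>\<beta> \<in> B\<close> by (simp add: fiber_def)
  then show "fiber B j \<delta> \<noteq> {}" by blast
qed

text \<open>A finite fibre is nonempty exactly if its cardinality is positive, so compression meets
  the same lines in direction \<open>j\<close>. Fibrewise sums over \<open>B\<close> and
  \<open>compress j B\<close> thus have the same outer index set.\<close>

lemma base_compress:
  assumes "finite B"
  shows "(\<lambda>\<beta>. \<beta>(j := 0)) ` compress j B = (\<lambda>\<beta>. \<beta>(j := 0)) ` B" (is "?p ` ?C = ?p ` B")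
proof -
  have ne: "fiber ?C j \<delta> \<noteq> {} \<longleftrightarrow> fiber B j \<delta> \<noteq> {}" for \<delta>
    using finite_fiber[OF assms, of j \<delta>] by (auto simp: fiber_compress card_gt_0_iff lessThan_empty_iff)
  have "\<delta> \<in> ?p ` ?C \<longleftrightarrow> \<delta> \<in> ?p ` B" if "\<delta> j = 0" for \<delta>
  proof -
    have "\<delta>(j := 0) = \<delta>" using that by auto
    then show ?thesis using fiber_nonempty_iff[of B j \<delta>] fiber_nonempty_iff[of ?C j \<delta>] ne[of \<delta>]
      by simp
  qed
  moreover have "\<delta> j = 0" if "\<delta> \<in> ?p ` ?C \<or> \<delta> \<in> ?p ` B" for \<delta> using that by auto
  ultimately show ?thesis by blast
qed

lemma finite_compress:
  assumes "finite B"
  shows "finite (compress j B)"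
proof -
  have "compress j B \<subseteq> (\<Union>\<delta>\<in>(\<lambda>\<beta>. \<beta>(j := 0)) ` B. (\<lambda>a. \<delta>(j := a)) ` {..<card (fiber B j \<delta>)})"
  proof
    fix \<beta> assume b: "\<beta> \<in> compress j B"
    then have "\<beta>(j := 0) \<in> (\<lambda>\<beta>. \<beta>(j := 0)) ` B" using base_compress[OF assms, of j] by blast
    moreover have "\<beta> \<in> (\<lambda>a. (\<beta>(j := 0))(j := a)) ` {..<card (fiber B j (\<beta>(j := 0)))}"
      using b by (intro image_eqI[of _ _ "\<beta> j"]) (auto simp: compress_def)
    ultimately show "\<beta> \<in> (\<Union>\<delta>\<in>(\<lambda>\<beta>. \<beta>(j := 0)) ` B. (\<lambda>a. \<delta>(j := a)) ` {..<card (fiber B j \<delta>)})"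
      by blast
  qed
  then show ?thesis using assms by (auto intro: finite_subset)
qed

lemma sum_fibers:
  assumes "finite B"
  shows "(\<Sum>\<beta>\<in>B. f \<beta>) = (\<Sum>\<delta>\<in>(\<lambda>\<beta>. \<beta>(j := 0)) ` B. \<Sum>a\<in>fiber B j \<delta>. f (\<delta>(j := a)))"
proof -
  have "(\<Sum>\<beta>\<in>{\<beta> \<in> B. \<beta>(j := 0) = \<delta>}. f \<beta>) = (\<Sum>a\<in>fiber B j \<delta>. f (\<delta>(j := a)))"
    if "\<delta> \<in> (\<lambda>\<beta>. \<beta>(j := 0)) ` B" for \<delta>
  proof -
    have d: "\<delta> j = 0" using that by auto
    show ?thesis
      by (rule sum.reindex_bij_witness[of _ "\<lambda>a. \<delta>(j := a)" "\<lambda>\<beta>. \<beta> j"])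
        (use d in \<open>auto simp: fiber_def\<close>)
  qed
  then show ?thesis
    by (subst sum.image_gen[OF assms, of _ "\<lambda>\<beta>. \<beta>(j := 0)"]) (rule sum.cong[OF refl])
qed

lemma card_compress:
  assumes "finite B"
  shows "card (compress j B) = card B"
proof -
  have "card (compress j B) = (\<Sum>\<beta>\<in>compress j B. 1)" by simp
  also have "\<dots> = (\<Sum>\<beta>\<in>B. 1)"
    by (subst (1 2) sum_fibers[where j = j]) 
      (simp_all add: assms finite_compress base_compress fiber_compress)
  finally show ?thesis by simp
qed

lemma down_closed_at_compress: "down_closed_at j (compress j B)"
  by (auto simp: down_closed_at_def compress_def)

text \<open>By closure in direction \<open>i\<close>, lowering the entry at \<open>i\<close> can
  only enlarge the fibre in direction \<open>j\<close>. Hence later compressions preserve what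
  earlier ones achieved.\<close>

lemma down_closed_at_compress_other:
  assumes "finite B" "down_closed_at i B" "i \<noteq> j"
  shows "down_closed_at i (compress j B)"
  unfolding down_closed_at_def
proof (intro ballI allI impI)
  fix \<beta> c assume b: "\<beta> \<in> compress j B" and c: "c \<le> \<beta> i"
  have "fiber B j \<beta> \<subseteq> fiber B j (\<beta>(i := c))"
  proof
    fix a assume "a \<in> fiber B j \<beta>"
    then have "(\<beta>(j := a))(i := c) \<in> B"
      using assms(2,3) c by (simp add: fiber_def down_closed_at_def)
    then show "a \<in> fiber B j (\<beta>(i := c))"
      using assms(3) by (simp add: fiber_def fun_upd_twist)
  qed
  then have "card (fiber B j \<beta>) \<le> card (fiber B j (\<beta>(i := c)))"
    using finite_fiber[OF assms(1)] by (rule card_mono[rotated])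
  then show "\<beta>(i := c) \<in> compress j B"
    using b assms(3) by (simp add: compress_def)
qed

lemma compress_vanish:
  assumes "finite B" "j \<in> J" "\<And>\<beta> i. \<beta> \<in> B \<Longrightarrow> i \<notin> J \<Longrightarrow> \<beta> i = 0" "\<beta> \<in> compress j B" "i \<notin> J"
  shows "\<beta> i = 0"
proof -
  have "\<beta>(j := 0) \<in> (\<lambda>\<beta>. \<beta>(j := 0)) ` B" using base_compress[OF assms(1), of j] assms(4) by blast
  then obtain \<beta>' where "\<beta>' \<in> B" "\<beta>(j := 0) = \<beta>'(j := 0)" by auto
  then show ?thesis using assms(2,3,5) by (metis fun_upd_other)
qed

lemma kernel_sum_fibers:
  assumes "finite B" "finite J" "j \<in> J"
  shows "kernel_sum J s B = (\<Sum>\<delta>\<in>(\<lambda>\<beta>. \<beta>(j := 0)) ` B. \<Sum>\<epsilon>\<in>(\<lambda>\<beta>. \<beta>(j := 0)) ` B.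
     (\<Prod>i\<in>J - {j}. s i ^ abs_diff \<delta> \<epsilon> i) *
     (\<Sum>a\<in>fiber B j \<delta>. \<Sum>b\<in>fiber B j \<epsilon>. s j ^ nat \<bar>int a - int b\<bar>))" (is "_ = ?R")
proof -
  have pr: "(\<Prod>i\<in>J. s i ^ abs_diff (\<delta>(j := a)) (\<epsilon>(j := b)) i)
    = (\<Prod>i\<in>J - {j}. s i ^ abs_diff \<delta> \<epsilon> i) * s j ^ nat \<bar>int a - int b\<bar>" for \<delta> \<epsilon> a b
    using assms(2,3) by (subst prod.remove[of _ j]) (auto simp: abs_diff_def intro!: prod.cong)
  let ?D = "(\<lambda>\<beta>. \<beta>(j := 0)) ` B"
  have "kernel_sum J s B = (\<Sum>\<delta>\<in>?D. \<Sum>a\<in>fiber B j \<delta>. \<Sum>\<epsilon>\<in>?D. \<Sum>b\<in>fiber B j \<epsilon>.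
     (\<Prod>i\<in>J. s i ^ abs_diff (\<delta>(j := a)) (\<epsilon>(j := b)) i))"
    unfolding kernel_sum_def sum_fibers[OF assms(1), of "\<lambda>\<beta>. \<Sum>\<mu>\<in>B. _ \<beta> \<mu>" j]
    by (intro sum.cong refl sum_fibers assms(1))
  also have "\<dots> = (\<Sum>\<delta>\<in>?D. \<Sum>\<epsilon>\<in>?D. \<Sum>a\<in>fiber B j \<delta>. \<Sum>b\<in>fiber B j \<epsilon>.
     (\<Prod>i\<in>J. s i ^ abs_diff (\<delta>(j := a)) (\<epsilon>(j := b)) i))"
    by (subst sum.swap) simp
  also have "\<dots> = ?R" unfolding pr by (simp add: sum_distrib_left)
  finally show ?thesis .
qed

text \<open>By \<open>kernel_sum_fibers\<close> both sides run over the same base points with the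
  same nonnegative coefficients; only the double sums over pairs of fibres differ, and
  \<open>double_sum_le_intervals\<close> compares these.\<close>

lemma kernel_sum_compress:
  assumes "finite B" "finite J" "j \<in> J" "\<And>i. i \<in> J \<Longrightarrow> 0 \<le> s i" "s j \<le> 1/2"
  shows "kernel_sum J s B \<le> kernel_sum J (s(j := 2 * s j)) (compress j B)"
proof -
  have e: "(\<Prod>i\<in>J - {j}. (s(j := 2 * s j)) i ^ abs_diff \<delta> \<epsilon> i) = (\<Prod>i\<in>J - {j}. s i ^ abs_diff \<delta> \<epsilon> i)"
    for \<delta> \<epsilon> by (intro prod.cong) auto
  show ?thesis
    unfolding kernel_sum_fibers[OF assms(1-3)]
      kernel_sum_fibers[OF finite_compress[OF assms(1)] assms(2,3)]
      base_compress[OF assms(1)] fiber_compress e fun_upd_same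
    using assms by (intro sum_mono mult_left_mono double_sum_le_intervals finite_fiber prod_nonneg) auto
qed

text \<open>The coordinates of \<open>L\<close> are compressed one at a time. Each is processed
  once, so at its turn its weight is still undoubled and at most 1/2.\<close>

lemma exists_down_closed:
  assumes "finite L" "L \<subseteq> J" "finite J" "finite B"
    and "\<And>\<beta> i. \<beta> \<in> B \<Longrightarrow> i \<notin> J \<Longrightarrow> \<beta> i = 0"
    and "\<And>i. i \<in> J \<Longrightarrow> 0 \<le> s i" "\<And>i. i \<in> L \<Longrightarrow> s i \<le> 1/2"
  shows "\<exists>B'. finite B' \<and> card B' = card B \<and> (\<forall>\<beta>\<in>B'. \<forall>i. i \<notin> J \<longrightarrow> \<beta> i = 0)
    \<and> (\<forall>j\<in>L. down_closed_at j B')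
    \<and> kernel_sum J s B \<le> kernel_sum J (\<lambda>i. if i \<in> L then 2 * s i else s i) B'"
  using assms(1,2,7)
proof (induction L)
  case empty
  then show ?case using assms by (intro exI[of _ B]) auto
next
  case (insert l L)
  then obtain B' where B': "finite B'" "card B' = card B" "\<forall>\<beta>\<in>B'. \<forall>i. i \<notin> J \<longrightarrow> \<beta> i = 0"
    "\<forall>j\<in>L. down_closed_at j B'"
    "kernel_sum J s B \<le> kernel_sum J (\<lambda>i. if i \<in> L then 2 * s i else s i) B'"
    by auto
  let ?s = "\<lambda>i. if i \<in> L then 2 * s i else s i"
  have l: "l \<in> J" "l \<notin> L" using insert by auto
  have "kernel_sum J ?s B' \<le> kernel_sum J (?s(l := 2 * ?s l)) (compress l B')"
    using B'(1) assms(3) l assms(6) insert.prems by (intro kernel_sum_compress) auto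
  also have "?s(l := 2 * ?s l) = (\<lambda>i. if i \<in> insert l L then 2 * s i else s i)"
    using l by auto
  finally have "kernel_sum J s B \<le> kernel_sum J (\<lambda>i. if i \<in> insert l L then 2 * s i else s i) (compress l B')"
    using B'(5) by linarith
  moreover have "\<forall>j\<in>insert l L. down_closed_at j (compress l B')"
    using B'(1,4) l down_closed_at_compress down_closed_at_compress_other by (metis insert_iff)
  moreover have "\<forall>\<beta>\<in>compress l B'. \<forall>i. i \<notin> J \<longrightarrow> \<beta> i = 0"
    using compress_vanish[OF B'(1) l(1)] B'(3) by blast
  ultimately show ?case
    using finite_compress[OF B'(1)] card_compress[OF B'(1)] B'(2) by (intro exI[of _ "compress l B'"]) auto
qed


section \<open>Asymmetric weights and the arithmetic-geometric mean inequality\<close>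

lemma sum_power_le_geometric:
  fixes x :: real
  assumes "finite A" "0 \<le> x" "x < 1"
  shows "(\<Sum>i\<in>A. x ^ i) \<le> inverse (1 - x)"
proof -
  have "(\<Sum>i\<in>A. x ^ i) \<le> (\<Sum>i. x ^ i)"
    using assms by (intro sum_le_suminf summable_geometric) auto
  also have "\<dots> = inverse (1 - x)"
    using assms by (subst suminf_geometric) (auto simp: inverse_eq_divide)
  finally show ?thesis .
qed

text \<open>The terms with b \<ge> a contribute at most 1/(1-q), those with b < a at most p/(1-p),
  and these bounds add up to (1-pq)/((1-p)(1-q)). For a = 0 the second kind is absent, so only
  nonzero entries cost a factor in \<open>p\<close>.\<close>

lemma two_sided_row_le:
  fixes p q :: real
  assumes "0 \<le> p" "p < 1" "0 \<le> q" "q < 1"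
  shows "(\<Sum>b\<le>M. p ^ (a - b) * q ^ (b - a)) \<le> inverse (1 - q) * (if a = 0 then 1 else inverse (1 - p))"
proof -
  have up: "(\<Sum>b\<in>{a..a+M}. q ^ (b - a)) = (\<Sum>i\<le>M. q ^ i)"
    by (rule sum.reindex_bij_witness[of _ "\<lambda>i. a + i" "\<lambda>b. b - a"]) auto
  have down: "(\<Sum>b<a. p ^ (a - b)) = p * (\<Sum>i<a. p ^ i)"
    unfolding sum_distrib_left
    by (rule sum.reindex_bij_witness[of _ "\<lambda>i. a - Suc i" "\<lambda>b. a - Suc b"])
      (auto simp flip: power_Suc simp: Suc_diff_Suc)
  have "(\<Sum>b\<le>M. p ^ (a - b) * q ^ (b - a)) \<le> (\<Sum>b\<in>{..<a} \<union> {a..a+M}. p ^ (a - b) * q ^ (b - a))"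
    using assms by (intro sum_mono2) auto
  also have "\<dots> = (\<Sum>b<a. p ^ (a - b) * q ^ (b - a)) + (\<Sum>b\<in>{a..a+M}. p ^ (a - b) * q ^ (b - a))"
    by (rule sum.union_disjoint) auto
  also have "\<dots> = p * (\<Sum>i<a. p ^ i) + (\<Sum>i\<le>M. q ^ i)"
    by (simp flip: up down)
  also have "\<dots> \<le> inverse (1 - q) * (if a = 0 then 1 else inverse (1 - p))"
  proof (cases "a = 0")
    case True
    then show ?thesis using sum_power_le_geometric[of "{..M}" q] assms by simp
  next
    case False
    have "p * (\<Sum>i<a. p ^ i) + (\<Sum>i\<le>M. q ^ i) \<le> p * inverse (1 - p) + inverse (1 - q)"
      using assms by (intro add_mono mult_left_mono sum_power_le_geometric) auto
    also have "\<dots> = (1 - p * q) * (inverse (1 - q) * inverse (1 - p))"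
      using assms by (simp add: field_simps)
    also have "\<dots> \<le> 1 * (inverse (1 - q) * inverse (1 - p))"
      using assms by (intro mult_right_mono) auto
    finally show ?thesis using False by simp
  qed
  finally show ?thesis .
qed

text \<open>Distinct elements of \<open>B\<close> restrict to distinct points of a finite box. The
  terms being nonnegative, the sum may be enlarged to the whole box, where it factorises.\<close>

lemma sum_prod_le_prod_sum:
  fixes f :: "nat \<Rightarrow> nat \<Rightarrow> real"
  assumes "finite B" "finite J" "inj_on (\<lambda>\<beta>. restrict \<beta> J) B"
    and "\<And>\<beta> j. \<beta> \<in> B \<Longrightarrow> j \<in> J \<Longrightarrow> \<beta> j \<le> M" "\<And>j b. 0 \<le> f j b"
  shows "(\<Sum>\<beta>\<in>B. \<Prod>j\<in>J. f j (\<beta> j)) \<le> (\<Prod>j\<in>J. \<Sum>b\<le>M. f j b)"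
proof -
  have "(\<Sum>\<beta>\<in>B. \<Prod>j\<in>J. f j (\<beta> j)) = (\<Sum>g\<in>(\<lambda>\<beta>. restrict \<beta> J) ` B. \<Prod>j\<in>J. f j (g j))"
    by (subst sum.reindex[OF assms(3)]) simp
  also have "\<dots> \<le> (\<Sum>g\<in>PiE J (\<lambda>_. {..M}). \<Prod>j\<in>J. f j (g j))"
    using assms by (intro sum_mono2 finite_PiE prod_nonneg) auto
  also have "\<dots> = (\<Prod>j\<in>J. \<Sum>b\<le>M. f j b)"
    using assms(2) by (simp add: prod_sum_PiE)
  finally show ?thesis .
qed

lemma kernel_sum_le_weights:
  assumes "finite B" "finite J" "\<And>\<beta> i. \<beta> \<in> B \<Longrightarrow> i \<notin> J \<Longrightarrow> \<beta> i = 0"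
    and p: "\<And>j. j \<in> J \<Longrightarrow> 0 \<le> p j \<and> p j < 1"
    and q: "\<And>j. j \<in> J \<Longrightarrow> 0 \<le> q j \<and> q j < 1"
    and s: "\<And>j. j \<in> J \<Longrightarrow> 0 \<le> s j \<and> (s j)\<^sup>2 = p j * q j"
  shows "kernel_sum J s B
    \<le> (\<Sum>\<beta>\<in>B. (\<Prod>j\<in>J. inverse (1 - q j)) * (\<Prod>j\<in>{j\<in>J. \<beta> j \<noteq> 0}. inverse (1 - p j)))"
proof -
  \<comment> \<open>The product \<open>P \<beta> \<mu> * P \<mu> \<beta>\<close> is the square of
    the symmetric kernel, and both orders of the arguments have the same double sum, so AM-GM leaves
    the double sum of \<open>P\<close> alone.\<close>
  define P where "P = (\<lambda>\<beta> \<mu>. \<Prod>j\<in>J. p j ^ (\<beta> j - \<mu> j) * q j ^ (\<mu> j - \<beta> j) :: real)"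
  \<comment> \<open>\<open>\<bar>\<beta> j - \<mu> j\<bar>\<close> is the sum of the two truncated differences.\<close>
  have AMGM: "(\<Prod>j\<in>J. s j ^ abs_diff \<beta> \<mu> j) \<le> (P \<beta> \<mu> + P \<mu> \<beta>) / 2" for \<beta> \<mu>
  proof (rule arith_geo_mean)
    have "(s j ^ abs_diff \<beta> \<mu> j)\<^sup>2 = (p j ^ (\<beta> j - \<mu> j) * q j ^ (\<mu> j - \<beta> j)) *
        (p j ^ (\<mu> j - \<beta> j) * q j ^ (\<beta> j - \<mu> j))" if "j \<in> J" for j
    proof -
      have "abs_diff \<beta> \<mu> j = (\<beta> j - \<mu> j) + (\<mu> j - \<beta> j)" by (auto simp: abs_diff_def)
      then have "(s j ^ abs_diff \<beta> \<mu> j)\<^sup>2 = (p j * q j) ^ ((\<beta> j - \<mu> j) + (\<mu> j - \<beta> j))"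
        using s[OF that] by (metis power_mult mult.commute)
      then show ?thesis by (simp add: power_add power_mult_distrib mult_ac)
    qed
    then show "(\<Prod>j\<in>J. s j ^ abs_diff \<beta> \<mu> j)\<^sup>2 = P \<beta> \<mu> * P \<mu> \<beta>"
      unfolding P_def prod.distrib[symmetric] prod_power_distrib by (rule prod.cong[OF refl])
  qed (unfold P_def, use p q in \<open>auto intro!: prod_nonneg mult_nonneg_nonneg zero_le_power\<close>)
  have "kernel_sum J s B \<le> (\<Sum>\<beta>\<in>B. \<Sum>\<mu>\<in>B. (P \<beta> \<mu> + P \<mu> \<beta>) / 2)"
    unfolding kernel_sum_def by (intro sum_mono AMGM)
  also have "\<dots> = ((\<Sum>\<beta>\<in>B. \<Sum>\<mu>\<in>B. P \<beta> \<mu>) + (\<Sum>\<beta>\<in>B. \<Sum>\<mu>\<in>B. P \<mu> \<beta>)) / 2"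
    by (simp add: sum.distrib sum_divide_distrib add_divide_distrib)
  also have "(\<Sum>\<beta>\<in>B. \<Sum>\<mu>\<in>B. P \<mu> \<beta>) = (\<Sum>\<beta>\<in>B. \<Sum>\<mu>\<in>B. P \<beta> \<mu>)"
    by (rule sum.swap)
  finally have main: "kernel_sum J s B \<le> (\<Sum>\<beta>\<in>B. \<Sum>\<mu>\<in>B. P \<beta> \<mu>)" by simp
  \<comment> \<open>Inserting 0 keeps the maximum meaningful when \<open>B\<close> or
    \<open>J\<close> is empty.\<close>
  define M where "M = Max (insert 0 ((\<lambda>(\<beta>, j). \<beta> j) ` (B \<times> J)))"
  have M: "\<beta> j \<le> M" if "\<beta> \<in> B" "j \<in> J" for \<beta> j
    unfolding M_def using that assms(1,2) by (intro Max_ge) force+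
  have inj: "inj_on (\<lambda>\<beta>. restrict \<beta> J) B"
  proof (rule inj_onI, rule ext)
    fix \<beta> \<mu> i assume "\<beta> \<in> B" "\<mu> \<in> B" "restrict \<beta> J = restrict \<mu> J"
    then show "\<beta> i = \<mu> i" using assms(3) by (cases "i \<in> J") (metis restrict_apply')+
  qed
  have "(\<Sum>\<mu>\<in>B. P \<beta> \<mu>) \<le> (\<Prod>j\<in>J. inverse (1 - q j)) * (\<Prod>j\<in>{j\<in>J. \<beta> j \<noteq> 0}. inverse (1 - p j))"
    if "\<beta> \<in> B" for \<beta>
  proof -
    \<comment> \<open>The value 0 off \<open>J\<close> supplies the nonnegativity at all indices
      that \<open>sum_prod_le_prod_sum\<close> asks for; \<open>p\<close> and \<open>q\<close> are
      controlled on \<open>J\<close> only.\<close>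
    define f where "f = (\<lambda>j b. if j \<in> J then p j ^ (\<beta> j - b) * q j ^ (b - \<beta> j) else 0)"
    have "(\<Sum>\<mu>\<in>B. P \<beta> \<mu>) = (\<Sum>\<mu>\<in>B. \<Prod>j\<in>J. f j (\<mu> j))"
      unfolding P_def f_def by (intro sum.cong prod.cong) auto
    also have "\<dots> \<le> (\<Prod>j\<in>J. \<Sum>b\<le>M. f j b)"
      using assms(1,2) inj M p q by (intro sum_prod_le_prod_sum) (auto simp: f_def)
    also have "\<dots> \<le> (\<Prod>j\<in>J. inverse (1 - q j) * (if \<beta> j = 0 then 1 else inverse (1 - p j)))"
    proof (rule prod_mono)
      fix j assume j: "j \<in> J"
      show "0 \<le> (\<Sum>b\<le>M. f j b) \<and> (\<Sum>b\<le>M. f j b)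
        \<le> inverse (1 - q j) * (if \<beta> j = 0 then 1 else inverse (1 - p j))"
        using two_sided_row_le[of "p j" "q j" "\<beta> j" M] p[OF j] q[OF j] j
        by (auto simp: f_def intro!: sum_nonneg)
    qed
    also have "\<dots> = (\<Prod>j\<in>J. inverse (1 - q j)) * (\<Prod>j\<in>{j\<in>J. \<beta> j \<noteq> 0}. inverse (1 - p j))"
      unfolding prod.distrib using assms(2) by (subst prod.inter_filter) (auto intro!: prod.cong)
    finally show ?thesis .
  qed
  then show ?thesis using main by (meson order_trans sum_mono)
qed


section \<open>Supports and separating coordinates\<close>

lemma card_support_le:
  assumes "finite B" "finite L" "\<And>j. j \<in> L \<Longrightarrow> down_closed_at j B" "\<beta> \<in> B"
  shows "2 ^ card {j \<in> L. \<beta> j \<noteq> 0} \<le> card B"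
proof -
  define T where "T = {j \<in> L. \<beta> j \<noteq> 0}"
  have fT: "finite T" using assms(2) by (simp add: T_def)
  \<comment> \<open>Setting any part of \<open>T\<close> to zero stays inside \<open>B\<close>, and
    different parts give different points: this produces \<open>2 ^ card T\<close> elements.\<close>
  let ?z = "\<lambda>X i. if i \<in> X then 0 else \<beta> i"
  have "?z X \<in> B" if "X \<subseteq> T" for X
    using finite_subset[OF that fT] that
  proof (induction X)
    case empty
    then show ?case using assms(4) by simp
  next
    case (insert x X)
    then have "down_closed_at x B" "?z X \<in> B" using assms(3) by (auto simp: T_def)
    then have "(?z X)(x := 0) \<in> B" by (simp add: down_closed_at_def)
    moreover have "(?z X)(x := 0) = ?z (insert x X)" by auto
    ultimately show ?case by simp
  qed
  then have "?z ` Pow T \<subseteq> B" by blast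
  moreover have "inj_on ?z (Pow T)"
  proof (rule inj_onI)
    fix X Y assume XY: "X \<in> Pow T" "Y \<in> Pow T" "?z X = ?z Y"
    show "X = Y"
    proof (rule set_eqI)
      fix j
      have "\<beta> j \<noteq> 0" if "j \<in> X \<or> j \<in> Y" using that XY(1,2) by (auto simp: T_def)
      then show "j \<in> X \<longleftrightarrow> j \<in> Y" using fun_cong[OF XY(3), of j] by (auto split: if_splits)
    qed
  qed
  ultimately have "card (Pow T) \<le> card B" using assms(1) card_inj_on_le by blast
  then show ?thesis using card_Pow[OF fT] by (simp add: T_def)
qed

text \<open>If \<open>J\<close> separates \<open>B\<close>, at most one element of \<open>B\<close>
  agrees with a new one on \<open>J\<close>, so one further coordinate suffices. It is at least 1
  because multi-indices vanish at 0.\<close>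

lemma exists_separating:
  assumes "finite B" "B \<noteq> {}" "B \<subseteq> multi_indices"
  shows "\<exists>J. finite J \<and> J \<subseteq> {1..} \<and> card J \<le> card B - 1 \<and> inj_on (\<lambda>\<beta>. restrict \<beta> J) B"
  using assms
proof (induction B rule: finite_ne_induct)
  case (singleton \<beta>)
  then show ?case by (intro exI[of _ "{}"]) auto
next
  case (insert \<beta> B)
  have "B \<subseteq> multi_indices" using insert.prems by simp
  from insert.IH[OF this] obtain J where J: "finite J" "J \<subseteq> {1..}" "card J \<le> card B - 1"
    and inj: "inj_on (\<lambda>\<beta>. restrict \<beta> J) B" by blast
  have inj': "\<alpha> = \<alpha>'" if "\<alpha> \<in> B" "\<alpha>' \<in> B" "restrict \<alpha> J = restrict \<alpha>' J" for \<alpha> \<alpha>'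
    using inj that unfolding inj_on_def by blast
  have pos: "card B > 0" using insert by (simp add: card_gt_0_iff)
  show ?case
  proof (cases "\<exists>\<mu>\<in>B. restrict \<mu> J = restrict \<beta> J")
    case False
    then have "inj_on (\<lambda>\<beta>. restrict \<beta> J) (insert \<beta> B)" 
      using inj unfolding inj_on_insert image_iff by (metis DiffD1)
    moreover have "card J \<le> card (insert \<beta> B) - 1" using J(3) insert.hyps by simp
    ultimately show ?thesis using J(1,2) by (intro exI[of _ J] conjI)
  next
    case True
    then obtain \<mu> where m: "\<mu> \<in> B" "restrict \<mu> J = restrict \<beta> J" by blast
    then have "\<mu> \<noteq> \<beta>" using insert by auto
    then obtain k where k: "\<mu> k \<noteq> \<beta> k" by auto
    have "\<mu> 0 = 0" "\<beta> 0 = 0" using m insert by (auto simp: multi_indices_def)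
    then have "k \<ge> 1" using k by (cases k) auto
    let ?J = "insert k J"
    have sub: "restrict \<alpha> J = restrict \<alpha>' J" if "restrict \<alpha> ?J = restrict \<alpha>' ?J"
      for \<alpha> \<alpha>' :: "nat \<Rightarrow> nat"
    proof
      fix i show "restrict \<alpha> J i = restrict \<alpha>' J i"
        using fun_cong[OF that, of i] by (auto simp: restrict_def split: if_splits)
    qed
    have inj'': "inj_on (\<lambda>\<beta>. restrict \<beta> ?J) B"
    proof (rule inj_onI)
      fix \<alpha> \<alpha>' assume mem: "\<alpha> \<in> B" "\<alpha>' \<in> B" and eq: "restrict \<alpha> ?J = restrict \<alpha>' ?J"
      show "\<alpha> = \<alpha>'" by (rule inj'[OF mem sub[OF eq]])
    qed
    have ne: "restrict \<alpha> ?J \<noteq> restrict \<beta> ?J" if "\<alpha> \<in> B" for \<alpha>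
    proof
      assume eq: "restrict \<alpha> ?J = restrict \<beta> ?J"
      have "restrict \<alpha> J = restrict \<mu> J" using sub[OF eq] m(2) by (rule trans[OF _ sym])
      then have "\<alpha> = \<mu>" by (rule inj'[OF that m(1)])
      moreover have "\<alpha> k = \<beta> k" using fun_cong[OF eq, of k] by simp
      ultimately show False using k by simp
    qed
    have "restrict \<beta> ?J \<notin> (\<lambda>\<beta>. restrict \<beta> ?J) ` (B - {\<beta>})"
    proof
      assume "restrict \<beta> ?J \<in> (\<lambda>\<beta>. restrict \<beta> ?J) ` (B - {\<beta>})"
      then obtain \<alpha> where "\<alpha> \<in> B - {\<beta>}" "restrict \<beta> ?J = restrict \<alpha> ?J" by (rule imageE)
      then show False using ne[of \<alpha>] by simp
    qed
    with inj'' have "inj_on (\<lambda>\<beta>. restrict \<beta> ?J) (insert \<beta> B)"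
      unfolding inj_on_insert by (rule conjI)
    moreover have "card ?J \<le> card (insert \<beta> B) - 1"
      using J pos insert.hyps by (simp add: card_insert_if) linarith
    moreover have "finite ?J" "?J \<subseteq> {1..}" using J(1,2) \<open>k \<ge> 1\<close> by auto
    ultimately show ?thesis by (intro exI[of _ ?J] conjI)
  qed
qed

lemma mi_power_abs_diff_le:
  assumes "\<forall>j\<ge>1. 0 < t j \<and> t j < 1" "\<beta> \<in> multi_indices" "\<mu> \<in> multi_indices"
    and J: "finite J" "J \<subseteq> {1..}"
  shows "mi_power t (abs_diff \<beta> \<mu>) \<le> (\<Prod>j\<in>J. t j ^ abs_diff \<beta> \<mu> j)"
proof -
  let ?D = "{j. abs_diff \<beta> \<mu> j \<noteq> 0}"
  have "?D \<subseteq> {j. \<beta> j \<noteq> 0} \<union> {j. \<mu> j \<noteq> 0}" by (auto simp: abs_diff_def)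
  then have fin: "finite ?D"
    using assms(2,3) by (auto simp: multi_indices_def intro: finite_subset)
  have "abs_diff \<beta> \<mu> 0 = 0" using assms(2,3) by (simp add: multi_indices_def abs_diff_def)
  then have pos: "j \<ge> 1" if "j \<in> ?D \<union> J" for j
    using that J(2) by (cases j) auto
  \<comment> \<open>Neither of \<open>J\<close> and the support of the difference need contain the
    other. In their union, indices off the support contribute 1, and those off \<open>J\<close> give
    factors at most 1.\<close>
  have "mi_power t (abs_diff \<beta> \<mu>) = (\<Prod>j\<in>?D \<union> J. t j ^ abs_diff \<beta> \<mu> j)"
    unfolding mi_power_def using fin J by (intro prod.mono_neutral_left) auto
  also have "\<dots> = (\<Prod>j\<in>(?D \<union> J) - J. t j ^ abs_diff \<beta> \<mu> j) * (\<Prod>j\<in>J. t j ^ abs_diff \<beta> \<mu> j)"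
    using fin J by (intro prod.subset_diff) auto
  also have "\<dots> \<le> (\<Prod>j\<in>J. t j ^ abs_diff \<beta> \<mu> j)"
    using assms(1) pos
    by (intro mult_left_le_one_le prod_nonneg prod_le_1) (auto simp: power_le_one less_imp_le)
  finally show ?thesis .
qed

section \<open>Ranks and the product of the weights\<close>

definition rank :: "nat set \<Rightarrow> nat \<Rightarrow> nat" where
  "rank J j = card {i \<in> J. i \<le> j}"

lemma bij_betw_rank:
  assumes "finite J"
  shows "bij_betw (rank J) J {1..card J}"
proof -
  have less: "rank J i < rank J j" if "i \<in> J" "j \<in> J" "i < j" for i j
  proof -
    have "j \<in> {k \<in> J. k \<le> j} - {k \<in> J. k \<le> i}" using that by auto
    moreover have "{k \<in> J. k \<le> i} \<subseteq> {k \<in> J. k \<le> j}" using that by auto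
    ultimately have "{k \<in> J. k \<le> i} \<subset> {k \<in> J. k \<le> j}" by blast
    then show ?thesis unfolding rank_def using assms by (intro psubset_card_mono) auto
  qed
  have inj: "inj_on (rank J) J"
    by (rule inj_onI) (metis less less_irrefl linorder_neqE_nat)
  have "rank J ` J \<subseteq> {1..card J}"
    using assms by (auto simp: rank_def Suc_le_eq card_gt_0_iff intro!: card_mono)
  then have "rank J ` J = {1..card J}"
    using inj by (intro card_subset_eq) (auto simp: card_image)
  then show ?thesis using inj by (simp add: bij_betw_def)
qed

text \<open>Only numbers from 1 to \<open>j\<close> are counted. Consequently a decreasing sequence
  at \<open>j\<close> is bounded by its value at the rank of \<open>j\<close>.\<close>

lemma rank_le:
  assumes "J \<subseteq> {1..}"
  shows "rank J j \<le> j"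
proof -
  have "rank J j \<le> card {1..j}" unfolding rank_def using assms by (intro card_mono) auto
  then show ?thesis by simp
qed

text \<open>Coordinates with \<open>t j \<ge> 1/2\<close> are not compressed, so their nonzero
  entries are counted separately; this is the source of \<open>kappa t\<close> in
  \<open>r\<close>.\<close>

lemma card_large_le_kappa:
  assumes "t \<longlonglongrightarrow> 0" "J \<subseteq> {1..}"
  shows "card {j \<in> J. t j \<ge> 1/2} \<le> kappa t"
proof -
  have "j \<le> kappa t" if "1 \<le> j" "t j \<ge> 1/2" for j
    using that kappa_set_finite[OF assms(1)] by (auto simp: kappa_def intro!: Max_ge)
  then have "{j \<in> J. t j \<ge> 1/2} \<subseteq> {1..kappa t}" using assms(2) by auto
  then have "card {j \<in> J. t j \<ge> 1/2} \<le> card {1..kappa t}" by (intro card_mono) auto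
  then show ?thesis by simp
qed

text \<open>Renumbering by rank can only increase the first factors, and since all of them are at
  least 1 the product may extend to \<open>n\<close>. The set \<open>T\<close> occupies only some
  ranks; as 1/(1 - \<open>V i\<close>) is antitone in i, the worst case is that it occupies the
  first ones.\<close>

lemma weights_product_le:
  fixes \<tau> V :: "nat \<Rightarrow> real"
  assumes J: "finite J" "J \<subseteq> {1..}" "card J \<le> n" and T: "T \<subseteq> J" "card T \<le> r"
    and \<tau>: "\<And>j. 1 \<le> j \<Longrightarrow> 0 < \<tau> j" "antimono_on {1..} \<tau>"
    and V: "\<And>i. 1 \<le> i \<Longrightarrow> V i < 1 \<and> (\<tau> i)\<^sup>2 < V i" "antimono_on {1..} V"
  shows "(\<Prod>j\<in>J. inverse (1 - inverse (V (rank J j)) * (\<tau> j)\<^sup>2)) * (\<Prod>j\<in>T. inverse (1 - V (rank J j)))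
    \<le> (\<Prod>i=1..n. inverse (1 - inverse (V i) * (\<tau> i)\<^sup>2)) * (\<Prod>i=1..r. inverse (1 - V i))"
proof (rule mult_mono)
  let ?G = "\<lambda>i. inverse (1 - inverse (V i) * (\<tau> i)\<^sup>2)" and ?H = "\<lambda>i. inverse (1 - V i)"
  have Vpos: "0 < V i" if "1 \<le> i" for i using V(1)[OF that] by (smt (verit) zero_le_power2)
  have rank: "1 \<le> rank J j" "rank J j \<le> j" if "j \<in> J" for j
    using bij_betw_rank[OF J(1)] that rank_le[OF J(2)] by (auto simp: bij_betw_def)
  have G1: "1 \<le> ?G i" if "1 \<le> i" for i
    using V(1)[OF that] Vpos[OF that] by (intro one_le_inverse) (auto simp: field_simps)
  have G0: "0 \<le> ?G i" if "1 \<le> i" for i using G1[OF that] by linarith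
  have H: "0 \<le> ?H i" "1 \<le> ?H i" if "1 \<le> i" for i
    using V(1)[OF that] Vpos[OF that] by (auto intro: one_le_inverse)
  have Hanti: "?H k \<le> ?H i" if "1 \<le> i" "i \<le> k" for i k
    using V(1)[of i] V(1)[of k] monotone_onD[OF V(2), of i k] that
    by (auto intro!: le_imp_inverse_le)
  have factor: "0 \<le> inverse (1 - inverse (V (rank J j)) * (\<tau> j)\<^sup>2) \<and>
    inverse (1 - inverse (V (rank J j)) * (\<tau> j)\<^sup>2) \<le> ?G (rank J j)" if j: "j \<in> J" for j
  proof -
    have "(\<tau> j)\<^sup>2 \<le> (\<tau> (rank J j))\<^sup>2"
      using rank[OF j] J(2) j monotone_onD[OF \<tau>(2), of "rank J j" j] \<tau>(1)[of j]
      by (intro power_mono) auto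
    then have "inverse (V (rank J j)) * (\<tau> j)\<^sup>2 \<le> inverse (V (rank J j)) * (\<tau> (rank J j))\<^sup>2"
      using Vpos rank(1)[OF j] by (intro mult_left_mono) (auto simp: less_imp_le)
    moreover have "inverse (V (rank J j)) * (\<tau> (rank J j))\<^sup>2 < 1"
      using V(1) Vpos rank(1)[OF j] by (simp add: field_simps)
    ultimately show ?thesis by (auto intro!: le_imp_inverse_le)
  qed
  show "(\<Prod>j\<in>J. inverse (1 - inverse (V (rank J j)) * (\<tau> j)\<^sup>2)) \<le> (\<Prod>i=1..n. ?G i)"
  proof -
    have "(\<Prod>j\<in>J. inverse (1 - inverse (V (rank J j)) * (\<tau> j)\<^sup>2)) \<le> (\<Prod>j\<in>J. ?G (rank J j))"
      using factor by (intro prod_mono) auto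
    also have "\<dots> = (\<Prod>i=1..card J. ?G i)"
      using bij_betw_rank[OF J(1)] by (rule prod.reindex_bij_betw)
    also have "\<dots> \<le> (\<Prod>i=1..n. ?G i)"
      using J(3) by (intro prod_mono2) (auto intro!: G0 G1 simp del: inverse_nonnegative_iff_nonnegative)
    finally show ?thesis .
  qed
  show "(\<Prod>j\<in>T. ?H (rank J j)) \<le> (\<Prod>i=1..r. ?H i)"
  proof -
    have inj: "inj_on (rank J) T"
      using bij_betw_rank[OF J(1)] T(1) by (meson bij_betw_def inj_on_subset)
    have "(\<Prod>j\<in>T. ?H (rank J j)) = (\<Prod>i\<in>rank J ` T. ?H i)"
      by (simp add: prod.reindex[OF inj])
    also have "\<dots> \<le> (\<Prod>i=1..card (rank J ` T). ?H i)"
      using finite_subset[OF T(1) J(1)] rank(1) T(1) H Hanti by (intro prod_le_initial_prod) auto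
    also have "\<dots> = (\<Prod>i=1..card T. ?H i)" by (simp add: card_image[OF inj])
    also have "\<dots> \<le> (\<Prod>i=1..r. ?H i)"
      using T(2) by (intro prod_mono2) (auto intro!: H simp del: inverse_nonnegative_iff_nonnegative)
    finally show ?thesis .
  qed
  show "0 \<le> (\<Prod>i=1..n. ?G i)"
    by (intro prod_nonneg ballI G0) simp
  show "0 \<le> (\<Prod>j\<in>T. ?H (rank J j))"
    using H rank(1) T(1) by (intro prod_nonneg) auto
qed

section \<open>Assembly of the bound, for a single set and for the supremum\<close>

lemma S_le_weights_product:
  fixes t \<tau> V :: "nat \<Rightarrow> real"
  assumes t: "\<forall>j\<ge>1. 0 < t j \<and> t j < 1" "t \<longlonglongrightarrow> 0"
    and \<tau>: "\<tau> = (\<lambda>j. eta (t j))" "antimono_on {1..} \<tau>"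
    and V: "\<And>i. 1 \<le> i \<Longrightarrow> V i < 1 \<and> (\<tau> i)\<^sup>2 < V i" "antimono_on {1..} V"
    and N: "N \<ge> 1" "N - 1 \<le> n" and r: "\<And>m. 2 ^ m \<le> N \<Longrightarrow> m + kappa t \<le> r"
    and B: "B \<in> index_sets N"
  shows "S t B \<le> (\<Prod>i=1..n. inverse (1 - inverse (V i) * (\<tau> i)\<^sup>2)) * (\<Prod>i=1..r. inverse (1 - V i))"
    (is "_ \<le> ?R")
proof -
  have cB: "card B = N" and Bsub: "B \<subseteq> multi_indices" using B by (auto simp: index_sets_def)
  have fB: "finite B" "B \<noteq> {}" using cB N by (auto intro: card_ge_0_finite)
  obtain J where J: "finite J" "J \<subseteq> {1..}" "card J \<le> N - 1"
    and inj: "inj_on (\<lambda>\<beta>. restrict \<beta> J) B"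
    using exists_separating[OF fB Bsub] cB by blast
  have \<tau>pos: "0 < \<tau> j" if "1 \<le> j" for j using t(1) that by (simp add: \<tau>(1) eta_def)
  have Vpos: "0 < V i" if "1 \<le> i" for i using V(1)[OF that] by (smt (verit) zero_le_power2)
  \<comment> \<open>Erasing the entries off \<open>J\<close> is injective on \<open>B\<close> and
    does not change the kernel over \<open>J\<close>; it yields the vanishing off \<open>J\<close>
    that \<open>exists_down_closed\<close> requires.\<close>
  let ?z = "\<lambda>\<beta> j. if j \<in> J then \<beta> j else (0::nat)"
  have injz: "inj_on ?z B"
  proof (rule inj_onI)
    fix \<beta> \<mu> assume "\<beta> \<in> B" "\<mu> \<in> B" and eq: "?z \<beta> = ?z \<mu>"
    moreover have "restrict \<beta> J = restrict \<mu> J"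
    proof (rule restrict_ext)
      fix i assume "i \<in> J"
      then show "\<beta> i = \<mu> i" using fun_cong[OF eq, of i] by simp
    qed
    ultimately show "\<beta> = \<mu>" using inj by (meson inj_onD)
  qed
  define L where "L = {j \<in> J. t j < 1/2}"
  have "\<exists>B'. finite B' \<and> card B' = card (?z ` B) \<and> (\<forall>\<beta>\<in>B'. \<forall>i. i \<notin> J \<longrightarrow> \<beta> i = 0)
    \<and> (\<forall>j\<in>L. down_closed_at j B')
    \<and> kernel_sum J t (?z ` B) \<le> kernel_sum J (\<lambda>i. if i \<in> L then 2 * t i else t i) B'"
    using J fB t(1) by (intro exists_down_closed) (auto simp: L_def less_imp_le subset_iff)
  then obtain B' where B': "finite B'" "card B' = N" "\<And>\<beta> i. \<beta> \<in> B' \<Longrightarrow> i \<notin> J \<Longrightarrow> \<beta> i = 0"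
    "\<And>j. j \<in> L \<Longrightarrow> down_closed_at j B'"
    and le: "kernel_sum J t (?z ` B) \<le> kernel_sum J (\<lambda>i. if i \<in> L then 2 * t i else t i) B'"
    using card_image[OF injz] cB by auto
  have eta: "kernel_sum J (\<lambda>i. if i \<in> L then 2 * t i else t i) B' = kernel_sum J \<tau> B'"
    unfolding kernel_sum_def \<tau>(1) by (intro sum.cong prod.cong) (auto simp: eta_def L_def)
  have "(\<Sum>\<beta>\<in>B. \<Sum>\<mu>\<in>B. mi_power t (abs_diff \<beta> \<mu>)) \<le> kernel_sum J t B"
    unfolding kernel_sum_def
    using t(1) Bsub J(1,2) by (intro sum_mono mi_power_abs_diff_le) auto
  also have "\<dots> = kernel_sum J t (?z ` B)"
    unfolding kernel_sum_def sum.reindex[OF injz]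
    by (auto simp: abs_diff_def intro!: sum.cong prod.cong)
  also have "\<dots> \<le> kernel_sum J \<tau> B'" using le eta by simp
  \<comment> \<open>Here \<open>q\<close> is forced by p q = \<tau>^2 once \<open>p\<close> is the
    \<open>V\<close> at the rank. It is below 1 because \<tau> at \<open>j\<close> is at most \<tau>
    at the rank of \<open>j\<close>.\<close>
  also have "\<dots> \<le> (\<Sum>\<beta>\<in>B'. (\<Prod>j\<in>J. inverse (1 - inverse (V (rank J j)) * (\<tau> j)\<^sup>2)) *
      (\<Prod>j\<in>{j\<in>J. \<beta> j \<noteq> 0}. inverse (1 - V (rank J j))))"
  proof (rule kernel_sum_le_weights[where p = "\<lambda>j. V (rank J j)"])
    show "finite B'" "finite J" by fact+
    show "\<beta> i = 0" if "\<beta> \<in> B'" "i \<notin> J" for \<beta> i using B'(3) that .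
  next
    fix j assume j: "j \<in> J"
    then have 1: "1 \<le> j" "1 \<le> rank J j" "rank J j \<le> j"
      using bij_betw_rank[OF J(1)] rank_le[OF J(2)] J(2) by (auto simp: bij_betw_def)
    note p = Vpos[OF 1(2)]
    show "0 \<le> V (rank J j) \<and> V (rank J j) < 1" using V(1)[OF 1(2)] p by simp
    have "(\<tau> j)\<^sup>2 \<le> (\<tau> (rank J j))\<^sup>2"
      using 1 monotone_onD[OF \<tau>(2), of "rank J j" j] \<tau>pos[of j] by (intro power_mono) auto
    also have "\<dots> < V (rank J j)" using V(1)[OF 1(2)] by simp
    finally show "0 \<le> inverse (V (rank J j)) * (\<tau> j)\<^sup>2 \<and> inverse (V (rank J j)) * (\<tau> j)\<^sup>2 < 1"
      using p by (simp add: field_simps)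
    show "0 \<le> \<tau> j \<and> (\<tau> j)\<^sup>2 = V (rank J j) * (inverse (V (rank J j)) * (\<tau> j)\<^sup>2)"
      using p \<tau>pos[OF 1(1)] by simp
  qed
  also have "\<dots> \<le> (\<Sum>\<beta>\<in>B'. ?R)"
  proof (rule sum_mono)
    fix \<beta> assume b: "\<beta> \<in> B'"
    let ?T = "{j \<in> J. \<beta> j \<noteq> 0}"
    \<comment> \<open>If m is the number of nonzero entries at compressed coordinates, then
      \<open>2 ^ m \<le> N\<close>; the remaining coordinates number at most
      \<open>kappa t\<close>.\<close>
    have "?T \<subseteq> {j \<in> L. \<beta> j \<noteq> 0} \<union> {j \<in> J. t j \<ge> 1/2}" by (auto simp: L_def)
    then have "card ?T \<le> card ({j \<in> L. \<beta> j \<noteq> 0} \<union> {j \<in> J. t j \<ge> 1/2})"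
      using J(1) by (intro card_mono) (auto simp: L_def)
    also have "\<dots> \<le> card {j \<in> L. \<beta> j \<noteq> 0} + card {j \<in> J. t j \<ge> 1/2}" by (rule card_Un_le)
    also have "\<dots> \<le> card {j \<in> L. \<beta> j \<noteq> 0} + kappa t"
      using card_large_le_kappa[OF t(2) J(2)] by simp
    also have "\<dots> \<le> r"
      using card_support_le[OF B'(1) _ B'(4) b, of L] J(1) B'(2) r by (simp add: L_def)
    finally have "card ?T \<le> r" .
    then show "(\<Prod>j\<in>J. inverse (1 - inverse (V (rank J j)) * (\<tau> j)\<^sup>2)) *
        (\<Prod>j\<in>?T. inverse (1 - V (rank J j))) \<le> ?R"
      using J N \<tau>pos \<tau>(2) V by (intro weights_product_le) auto
  qed
  also have "\<dots> = real N * ?R" by (simp add: B'(2))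
  finally show ?thesis unfolding S_def cB using N by (simp add: field_simps)
qed

theorem theorem4:
  fixes \<xi> :: real
  assumes "\<xi> > 1 / ln 2"
  shows "\<exists>C>0. \<forall>(t :: nat \<Rightarrow> real) (\<tau> :: nat \<Rightarrow> real) (N :: nat) (r :: nat) (v :: nat \<Rightarrow> real).
    (\<forall>j\<ge>1. 0 < t j \<and> t j < 1) \<longrightarrow>
    t \<longlonglongrightarrow> 0 \<longrightarrow>
    \<tau> = (\<lambda>j. eta (t j)) \<longrightarrow>
    antimono_on {1..} \<tau> \<longrightarrow>
    N \<ge> 3 \<longrightarrow>
    r = nat \<lfloor>\<xi> * ln (real N)\<rfloor> + kappa t \<longrightarrow>
    v 1 < 1 \<longrightarrow>
    antimono_on {1..r} v \<longrightarrow>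
    (\<forall>j\<in>{1..r}. v j > (\<tau> j)\<^sup>2) \<longrightarrow>
    Gamma_sup t N \<le>
      (\<Prod>j=1..r. inverse (1 - v j) * inverse (1 - inverse (v j) * (\<tau> j)\<^sup>2)) *
      (\<Prod>k=r+1..N-1. inverse (1 - inverse (v r) * (\<tau> k)\<^sup>2))
      + exp (C * (\<Sum>l=1..N-1. (t l)\<^sup>2))"
proof (intro exI[of _ "1::real"] conjI allI impI)
  fix t \<tau> :: "nat \<Rightarrow> real" and N r :: nat and v :: "nat \<Rightarrow> real"
  assume t: "\<forall>j\<ge>1. 0 < t j \<and> t j < 1" "t \<longlonglongrightarrow> 0"
    and \<tau>: "\<tau> = (\<lambda>j. eta (t j))" "antimono_on {1..} \<tau>"
    and N: "N \<ge> 3" and r: "r = nat \<lfloor>\<xi> * ln (real N)\<rfloor> + kappa t"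
    and v: "v 1 < 1" "antimono_on {1..r} v" "\<forall>j\<in>{1..r}. v j > (\<tau> j)\<^sup>2"
  \<comment> \<open>This is where \<xi> > 1 / ln 2 enters: m is at most log N / log 2, and being an
    integer it survives taking the integer part.\<close>
  have pow: "m + kappa t \<le> r" if "2 ^ m \<le> N" for m
  proof -
    have "real (2 ^ m) \<le> real N" using that by (simp only: of_nat_le_iff)
    then have "ln (2 ^ m) \<le> ln (real N)" using N by (subst ln_le_cancel_iff) auto
    then have "real m \<le> 1 / ln 2 * ln (real N)" by (simp add: ln_realpow field_simps)
    also have "\<dots> \<le> \<xi> * ln (real N)" using assms N by (intro mult_right_mono) auto
    finally have "m \<le> nat \<lfloor>\<xi> * ln (real N)\<rfloor>" by (simp add: le_nat_floor)
    then show ?thesis using r by simp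
  qed
  have r1: "1 \<le> r" using pow[of 1] N by simp
  \<comment> \<open>Ranks can exceed \<open>r\<close>, so \<open>v\<close> is continued by the
    constant \<open>v r\<close>; this produces the factors of the second product.\<close>
  define V where "V = (\<lambda>i. v (min i r))"
  have \<tau>pos: "0 < \<tau> j" if "1 \<le> j" for j using t(1) that by (simp add: \<tau>(1) eta_def)
  have Vanti: "antimono_on {1..} V"
    using monotone_onD[OF v(2)] r1 by (intro monotone_onI) (auto simp: V_def)
  have V: "V i < 1 \<and> (\<tau> i)\<^sup>2 < V i" if "1 \<le> i" for i
  proof -
    have "V i \<le> V 1" using monotone_onD[OF Vanti, of 1 i] that by simp
    moreover have "V 1 < 1" using v(1) r1 by (simp add: V_def min_def)
    moreover have "(\<tau> i)\<^sup>2 \<le> (\<tau> (min i r))\<^sup>2"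
      using monotone_onD[OF \<tau>(2), of "min i r" i] that r1 \<tau>pos[OF that] by (intro power_mono) auto
    moreover have "(\<tau> (min i r))\<^sup>2 < V i" using v(3) r1 that by (simp add: V_def)
    ultimately show ?thesis by linarith
  qed
  let ?G = "\<lambda>i. inverse (1 - inverse (V i) * (\<tau> i)\<^sup>2)"
  \<comment> \<open>The maximum covers both cases: \<open>r\<close> may exceed \<open>N - 1\<close>,
    and then the range from \<open>r+1\<close> to \<open>N-1\<close> is empty.\<close>
  have "Gamma_sup t N \<le> (\<Prod>i=1..max r (N - 1). ?G i) * (\<Prod>i=1..r. inverse (1 - V i))"
    unfolding Gamma_sup_def using index_sets_nonempty
  proof (rule cSUP_least)
    fix B assume B: "B \<in> index_sets N"
    show "S t B \<le> (\<Prod>i=1..max r (N - 1). ?G i) * (\<Prod>i=1..r. inverse (1 - V i))"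
      using N by (intro S_le_weights_product[OF t \<tau> V Vanti _ _ pow B]) auto
  qed
  also have "{1..max r (N - 1)} = {1..r} \<union> {r+1..N-1}" by auto
  also have "(\<Prod>i\<in>{1..r} \<union> {r+1..N-1}. ?G i) = (\<Prod>i=1..r. ?G i) * (\<Prod>i=r+1..N-1. ?G i)"
    by (rule prod.union_disjoint) auto
  also have "(\<Prod>i=1..r. ?G i) = (\<Prod>i=1..r. inverse (1 - inverse (v i) * (\<tau> i)\<^sup>2))"
    by (intro prod.cong) (auto simp: V_def)
  also have "(\<Prod>i=1..r. inverse (1 - V i)) = (\<Prod>i=1..r. inverse (1 - v i))"
    by (intro prod.cong) (auto simp: V_def)
  also have "(\<Prod>i=r+1..N-1. ?G i) = (\<Prod>i=r+1..N-1. inverse (1 - inverse (v r) * (\<tau> i)\<^sup>2))"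
    by (intro prod.cong) (auto simp: V_def)
  finally have "Gamma_sup t N \<le>
      (\<Prod>j=1..r. inverse (1 - v j) * inverse (1 - inverse (v j) * (\<tau> j)\<^sup>2)) *
      (\<Prod>k=r+1..N-1. inverse (1 - inverse (v r) * (\<tau> k)\<^sup>2))"
    by (simp add: prod.distrib mult_ac)
  \<comment> \<open>The exponential is positive, so adding it keeps the bound, and the constant 1
    serves as witness.\<close>
  then show "Gamma_sup t N \<le>
      (\<Prod>j=1..r. inverse (1 - v j) * inverse (1 - inverse (v j) * (\<tau> j)\<^sup>2)) *
      (\<Prod>k=r+1..N-1. inverse (1 - inverse (v r) * (\<tau> k)\<^sup>2))
      + exp (1 * (\<Sum>l=1..N-1. (t l)\<^sup>2))"
    by (rule order_trans) simp
qed simp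

end
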